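(* Let $\mathbb{D}=\{z\in\mathbb{C}:|z|<1\}$. For each positive integer $L$ let $g^L=g^L_1\,d\bar z_1+g^L_2\,d\bar z_2$ be the $(0,1)$-form on $\mathbb{D}^2$ with $$ g_1^L=\sum_{k=1}^L \bar z_1^{\,k-1}z_1^k\,\bar z_2^{\,k}z_2^k,\qquad g_2^L=\sum_{k=1}^L \bar z_1^{\,k}z_1^k\,\bar z_2^{\,k-1}z_2^k . $$ Then $\bar\partial g^L=0$ for every $L$, the norms $\|g^L\|_{L^1(\mathbb{D}^2)}$ are bounded independently of $L$, and there does not exist a constant $C$ such that $\|T(g^L)\|_{L^1(\mathbb{D}^2)}\le C\|g^L\|_{L^1(\mathbb{D}^2)}$ for all $L$, where $T$ is the integral solution operator for $\bar\partial$ on $\mathbb{D}^2$ given in the context.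
   Context: For a $\bar\partial$-closed $(0,1)$-form $f=f_1\,d\bar z_1+f_2\,d\bar z_2$ of class $C^1$ on $\overline{\mathbb{D}^2}$, $$ \begin{aligned} T(f)(z_1,z_2) &=\frac{-1}{2 \pi i}\int_{\mathbb{D}}\frac{f_2(z_1,\zeta_2)}{\zeta_2-z_2}\,d\bar \zeta_2\wedge d\zeta_2+\frac{-1}{2 \pi i}\int_{\mathbb{D}}\frac{f_1(\zeta_1,z_2)}{\zeta_1-z_1}\,d\bar \zeta_1\wedge d\zeta_1\\ &\quad+\frac{-1}{(2 \pi i)^2}\int_{\mathbb{D}^2}\frac{(\mathscr{D}f)(\zeta_1,\zeta_2)}{(\zeta_1-z_1)(\zeta_2-z_2)}\,d\bar \zeta_1\wedge d\zeta_1\wedge d\bar \zeta_2\wedge d\zeta_2, \end{aligned} $$ where $\mathscr{D} f =\frac{\partial f_1}{\partial \bar z_2}=\frac{\partial f_2}{\partial \bar z_1}$ and $d\bar\zeta\wedge d\zeta=2i\,dA(\zeta)$ in one complex variable. The $L^1$ norm of a $(0,1)$-form is $\|f\|_{L^1}=\|f_1\|_{L^1}+\|f_2\|_{L^1}$ (with respect to Lebesgue measure). *)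

theory Defs
  imports "HOL-Analysis.Analysis"
begin

abbreviation unit_disc :: "complex set" ("\<D>")
  where "\<D> \<equiv> ball 0 1"

abbreviation bidisc :: "(complex \<times> complex) set" ("\<D>\<^sup>2")
  where "\<D>\<^sup>2 \<equiv> \<D> \<times> \<D>"

text \<open>The pair \<open>(f1, f2)\<close> of coefficient functions stands for the form
  \<open>f1 d(cnj z1) + f2 d(cnj z2)\<close>.\<close>

type_synonym form01 = "(complex \<times> complex \<Rightarrow> complex) \<times> (complex \<times> complex \<Rightarrow> complex)"

text \<open>The Wirtinger operator \<open>(d/dx + \<i> d/dy) / 2\<close>, with \<open>z = x + \<i> y\<close>.\<close>

definition wirtinger_bar :: "(complex \<Rightarrow> complex) \<Rightarrow> complex \<Rightarrow> complex" where
  "wirtinger_bar h z =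
     (vector_derivative (\<lambda>x::real. h (z + of_real x)) (at 0)
      + \<i> * vector_derivative (\<lambda>y::real. h (z + \<i> * of_real y)) (at 0)) / 2"

definition wirtinger_bar1 :: "(complex \<times> complex \<Rightarrow> complex) \<Rightarrow> complex \<times> complex \<Rightarrow> complex" where
  "wirtinger_bar1 h = (\<lambda>(z1, z2). wirtinger_bar (\<lambda>w. h (w, z2)) z1)"

definition wirtinger_bar2 :: "(complex \<times> complex \<Rightarrow> complex) \<Rightarrow> complex \<times> complex \<Rightarrow> complex" where
  "wirtinger_bar2 h = (\<lambda>(z1, z2). wirtinger_bar (\<lambda>w. h (z1, w)) z2)"

text \<open>A \<open>(0,2)\<close>-form in two variables is represented by its coefficient with respect to
  \<open>d(cnj z1) \<and> d(cnj z2)\<close>.\<close>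

definition dbar :: "form01 \<Rightarrow> complex \<times> complex \<Rightarrow> complex" where
  "dbar = (\<lambda>(f1, f2) z. wirtinger_bar1 f2 z - wirtinger_bar2 f1 z)"

text \<open>On \<open>dbar\<close>-closed forms this is also \<open>wirtinger_bar1 f2\<close>.\<close>

definition mixed_deriv :: "form01 \<Rightarrow> complex \<times> complex \<Rightarrow> complex" ("\<DD>") where
  "\<DD> = (\<lambda>(f1, f2). wirtinger_bar2 f1)"

text \<open>Each factor \<open>2 * \<i>\<close> comes from \<open>d(cnj \<zeta>) \<and> d\<zeta> = 2 \<i> dA(\<zeta>)\<close>.\<close>

definition T_op :: "form01 \<Rightarrow> complex \<times> complex \<Rightarrow> complex" where
  "T_op = (\<lambda>(f1, f2) (z1, z2).
     (-1) / (2 * of_real pi * \<i>) *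
       (LINT \<zeta>2:\<D>|lborel. f2 (z1, \<zeta>2) / (\<zeta>2 - z2) * (2 * \<i>))
   + (-1) / (2 * of_real pi * \<i>) *
       (LINT \<zeta>1:\<D>|lborel. f1 (\<zeta>1, z2) / (\<zeta>1 - z1) * (2 * \<i>))
   + (-1) / (2 * of_real pi * \<i>)\<^sup>2 *
       (LINT \<zeta>:\<D>\<^sup>2|lborel.
          \<DD> (f1, f2) \<zeta> / ((fst \<zeta> - z1) * (snd \<zeta> - z2)) * (2 * \<i>)\<^sup>2))"

definition L1_norm :: "(complex \<times> complex \<Rightarrow> complex) \<Rightarrow> ennreal" where
  "L1_norm h = (\<integral>\<^sup>+z\<in>\<D>\<^sup>2. ennreal (norm (h z)) \<partial>lborel)"

definition L1_norm_form :: "form01 \<Rightarrow> ennreal" where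
  "L1_norm_form = (\<lambda>(f1, f2). L1_norm f1 + L1_norm f2)"

definition g_form :: "nat \<Rightarrow> form01" where
  "g_form L =
     ((\<lambda>(z1, z2). \<Sum>k=1..L. cnj z1 ^ (k - 1) * z1 ^ k * cnj z2 ^ k * z2 ^ k),
      (\<lambda>(z1, z2). \<Sum>k=1..L. cnj z1 ^ k * z1 ^ k * cnj z2 ^ (k - 1) * z2 ^ k))"

end

(* With u = |z1|^(2k) and v = |z2|^(2k), the one-variable Cauchy transform of cnj w^(k-1) w^k
   over the disc (normalised as in T) at z is (|z|^(2k) - 1)/k, because the average of
   w/(w - z) over rotations of w is 1 for |z| < |w| and 0 for |w| < |z|.  The three terms of T
   on the k-th summand are thus u (v - 1)/k, v (u - 1)/k and -(u - 1)(v - 1)/k, which add up to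
   (u v - 1)/k.  So T(g^L) has modulus of the order of the harmonic number H_L on a fixed set of
   positive measure, whereas the k-th summand of g^L has L1 norm O(1/k^2). *)

theory Submission
  imports Defs "HOL-Complex_Analysis.Winding_Numbers"
begin

text \<open>The failure originates in the third term of T: differentiating cnj z2^k brings down a
  factor k, which cancels one of the two factors 1/k produced by the double Cauchy transform,
  whereas the L1 norm of a summand of g^L keeps its quadratic decay. The terms (u v - 1)/k are all
  nonpositive, so nothing cancels in their sum, and for |z1| < 1/2 each of them is at most -3/(4k).
  The obstacle is that the rotations act under an area integral whose kernel has a pole inside the
  disc. Integrability of 1/|w| near 0 and rotation invariance of area allow the average and the area
  integral to be exchanged. The average is then a winding number, evaluated off the null circle |w|
  = |z|. Since T(g^L) is obtained exactly, the lower bound can be read off pointwise.\<close>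

section \<open>Radial integrals over the plane\<close>

text \<open>Polar coordinates for radial functions. The half-lines {..a} are closed under
  intersection and generate the Borel sets, so it suffices to compare the disc area pi a^2 with the
  integral of its derivative 2 pi r.\<close>

lemma distr_norm_lborel_complex:
  "distr lborel borel (norm :: complex \<Rightarrow> real) = density lborel (\<lambda>r. ennreal (2 * pi * r))"
    (is "?M = ?N")
proof -
  have M: "emeasure ?M {..a} = ennreal (pi * (max 0 a)\<^sup>2)" for a
  proof (cases "a \<ge> 0")
    case True
    have "norm -` {..a} = cball (0::complex) a"
      by auto
    with True show ?thesis
      by (simp add: emeasure_distr emeasure_cball unit_ball_vol_2)
  next
    case False
    then have "norm -` {..a} = ({} :: complex set)"
      by (auto dest: order_trans[OF norm_ge_zero])
    with False show ?thesis
      by (simp add: emeasure_distr)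
  qed
  have N: "emeasure ?N {..a} = ennreal (pi * (max 0 a)\<^sup>2)" for a
  proof -
    \<comment> \<open>\<open>ennreal\<close> sends negative reals to 0, so the density lives on the
      nonnegative half-line, and \<open>max 0 a\<close> covers both signs of a.\<close>
    have "emeasure ?N {..a} = (\<integral>\<^sup>+r. ennreal (2 * pi * r) * indicator {0..max 0 a} r \<partial>lborel)"
      by (subst emeasure_density)
         (auto intro!: nn_integral_cong simp: indicator_def ennreal_neg mult_nonneg_nonpos)
    also have "\<dots> = ennreal (pi * (max 0 a)\<^sup>2 - pi * 0\<^sup>2)"
      by (intro nn_integral_FTC_Icc) (auto intro!: derivative_eq_intros)
    finally show ?thesis by simp
  qed
  show ?thesis
  proof (rule measure_eqI_generator_eq[where E = "range atMost" and \<Omega> = UNIV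
        and A = "\<lambda>n. {..real n}"])
    show "Int_stable (range atMost :: real set set)"
      by (auto simp: Int_stable_def)
    show "(\<Union>i. {..real i}) = UNIV"
      using real_arch_simple by auto
    show "sets ?M = sigma_sets UNIV (range atMost)" "sets ?N = sigma_sets UNIV (range atMost)"
      by (simp_all add: borel_eq_atMost)
  qed (auto simp: M N)
qed

lemma nn_integral_radial:
  assumes [measurable]: "\<phi> \<in> borel_measurable borel"
  shows "(\<integral>\<^sup>+w. \<phi> (norm (w::complex)) \<partial>lborel) = (\<integral>\<^sup>+r. ennreal (2 * pi * r) * \<phi> r \<partial>lborel)"
proof -
  have "(\<integral>\<^sup>+w. \<phi> (norm (w::complex)) \<partial>lborel) = (\<integral>\<^sup>+r. \<phi> r \<partial>distr lborel borel (norm :: complex \<Rightarrow> real))"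
    by (subst nn_integral_distr) auto
  then show ?thesis
    by (simp add: distr_norm_lborel_complex nn_integral_density)
qed

lemma nn_integral_radial_annulus:
  assumes "0 \<le> a" "a \<le> b"
  shows "(\<integral>\<^sup>+w\<in>{w. a < norm w \<and> norm w < b}. ennreal (norm w ^ n) \<partial>(lborel :: complex measure))
    = ennreal (2 * pi * (b ^ (n + 2) - a ^ (n + 2)) / real (n + 2))"
proof -
  have "(\<integral>\<^sup>+w\<in>{w. a < norm w \<and> norm w < b}. ennreal (norm w ^ n) \<partial>(lborel :: complex measure))
      = (\<integral>\<^sup>+w. ennreal (norm w ^ n) * indicator {a<..<b} (norm w) \<partial>(lborel :: complex measure))"
    by (auto intro!: nn_integral_cong simp: indicator_def)
  also have "\<dots> = (\<integral>\<^sup>+r. ennreal (2 * pi * r) * (ennreal (r ^ n) * indicator {a<..<b} r) \<partial>lborel)"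
    by (subst nn_integral_radial[symmetric]) auto
  also have "\<dots> = (\<integral>\<^sup>+r. ennreal (2 * pi * r ^ (n + 1)) * indicator {a..b} r \<partial>lborel)"
  proof (rule nn_integral_cong_AE)
    \<comment> \<open>The fundamental theorem is applied on a closed interval, so the two endpoints
      of the open annulus are added as null points.\<close>
    have "AE r in lborel. r \<noteq> a \<and> r \<noteq> b"
      by (intro AE_conjI AE_lborel_singleton)
    then show "AE r in lborel. ennreal (2 * pi * r) * (ennreal (r ^ n) * indicator {a<..<b} r)
        = ennreal (2 * pi * r ^ (n + 1)) * indicator {a..b} r"
      by eventually_elim
        (use assms in \<open>auto simp: indicator_def ennreal_mult[symmetric] mult_ac\<close>)
  qed
  also have "\<dots> = ennreal (2 * pi / real (n + 2) * b ^ (n + 2) - 2 * pi / real (n + 2) * a ^ (n + 2))"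
  proof (intro nn_integral_FTC_Icc)
    fix r
    show "((\<lambda>r. 2 * pi / real (n + 2) * r ^ (n + 2)) has_real_derivative 2 * pi * r ^ (n + 1)) (at r)"
      using DERIV_cmult[OF DERIV_pow[of "n + 2" r UNIV], of "2 * pi / real (n + 2)"]
      by (simp add: mult.assoc)
  qed (use assms in auto)
  finally show ?thesis
    by (simp add: diff_divide_distrib right_diff_distrib)
qed

text \<open>The polar weight 2 pi r cancels the singularity 1/r, leaving a bounded integrand on a
  bounded interval. This is what makes the Cauchy kernel integrable in the plane.\<close>

lemma nn_integral_inverse_norm_ball_finite:
  "(\<integral>\<^sup>+w\<in>ball 0 R. ennreal (1 / norm w) \<partial>(lborel :: complex measure)) < \<infinity>"
proof -
  have "(\<integral>\<^sup>+w\<in>ball 0 R. ennreal (1 / norm w) \<partial>(lborel :: complex measure))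
      = (\<integral>\<^sup>+w. ennreal (1 / norm w) * indicator {..<R} (norm w) \<partial>(lborel :: complex measure))"
    by (auto intro!: nn_integral_cong simp: indicator_def)
  also have "\<dots> = (\<integral>\<^sup>+r. ennreal (2 * pi * r) * (ennreal (1 / r) * indicator {..<R} r) \<partial>lborel)"
    by (subst nn_integral_radial[symmetric]) auto
  also have "\<dots> \<le> (\<integral>\<^sup>+r. ennreal (2 * pi) * indicator {0..R} r \<partial>lborel)"
    by (intro nn_integral_mono)
       (auto simp: indicator_def ennreal_mult[symmetric] ennreal_neg not_le)
  also have "\<dots> < \<infinity>"
    by (subst nn_integral_cmult_indicator) (auto simp: ennreal_mult_less_top emeasure_lborel_Icc_eq)
  finally show ?thesis .
qed

section \<open>Translation and rotation invariance, angular averages\<close>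

lemma nn_integral_lborel_translate:
  fixes f :: "'a::euclidean_space \<Rightarrow> ennreal"
  assumes [measurable]: "f \<in> borel_measurable borel"
  shows "(\<integral>\<^sup>+x. f (c + x) \<partial>lborel) = (\<integral>\<^sup>+x. f x \<partial>lborel)"
  by (subst (2) lborel_distr_plus[of c, symmetric], subst nn_integral_distr) auto

text \<open>Uniqueness of Haar measure in miniature: \<open>\<integral>\<integral> indicator \<D> y * f (c * y + x) dx dy\<close> is computed in
  both orders by translation invariance; symmetry and rotation invariance of \<open>\<D>\<close> make the
  constants equal.\<close>

lemma nn_integral_lborel_rotate:
  fixes f :: "complex \<Rightarrow> ennreal"
  assumes [measurable]: "f \<in> borel_measurable borel" and c: "norm c = 1"
  shows "(\<integral>\<^sup>+x. f (c * x) \<partial>lborel) = (\<integral>\<^sup>+x. f x \<partial>lborel)"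
proof -
  let ?i = "indicator (ball 0 1) :: complex \<Rightarrow> ennreal"
  have [measurable]: "?i \<in> borel_measurable borel"
    by (intro borel_measurable_indicator) auto
  have I: "(\<integral>\<^sup>+x. ?i x \<partial>lborel) = ennreal pi"
    by (simp add: emeasure_ball unit_ball_vol_2)
  have c0: "c \<noteq> 0" using c by auto
  have "ennreal pi * (\<integral>\<^sup>+x. f x \<partial>lborel) = (\<integral>\<^sup>+y. ?i y * (\<integral>\<^sup>+x. f x \<partial>lborel) \<partial>lborel)"
    by (simp add: nn_integral_multc I)
  also have "\<dots> = (\<integral>\<^sup>+y. (\<integral>\<^sup>+x. ?i y * f (c * y + x) \<partial>lborel) \<partial>lborel)"
    by (simp add: nn_integral_cmult nn_integral_lborel_translate)
  also have "\<dots> = (\<integral>\<^sup>+x. (\<integral>\<^sup>+y. ?i y * f (c * y + x) \<partial>lborel) \<partial>lborel)"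
    by (rule lborel_pair.Fubini') (measurable)
  \<comment> \<open>Shifting y by -x/c moves x out of f and into the indicator. After another
    exchange the x-integral is the area of a translated disc, again pi.\<close>
  also have "\<dots> = (\<integral>\<^sup>+x. (\<integral>\<^sup>+y. ?i (- (x / c) + y) * f (c * y) \<partial>lborel) \<partial>lborel)"
  proof (rule nn_integral_cong)
    fix x
    have "(\<integral>\<^sup>+y. ?i y * f (c * y + x) \<partial>lborel) =
        (\<integral>\<^sup>+y. ?i (- (x / c) + y) * f (c * (- (x / c) + y) + x) \<partial>lborel)"
      by (rule nn_integral_lborel_translate[symmetric]) measurable
    then show "(\<integral>\<^sup>+y. ?i y * f (c * y + x) \<partial>lborel) =
        (\<integral>\<^sup>+y. ?i (- (x / c) + y) * f (c * y) \<partial>lborel)"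
      using c0 by (simp add: algebra_simps)
  qed
  also have "\<dots> = (\<integral>\<^sup>+y. (\<integral>\<^sup>+x. ?i (- (x / c) + y) * f (c * y) \<partial>lborel) \<partial>lborel)"
    by (rule lborel_pair.Fubini'[symmetric]) (measurable)
  also have "\<dots> = (\<integral>\<^sup>+y. (\<integral>\<^sup>+x. ?i (- (c * y) + x) \<partial>lborel) * f (c * y) \<partial>lborel)"
  proof (intro nn_integral_cong)
    fix y
    have "?i (- (x / c) + y) = ?i (- (c * y) + x)" for x
    proof -
      have "norm (- (x / c) + y) = norm (c * (- (x / c) + y))"
        by (simp only: norm_mult c mult_1)
      also have "c * (- (x / c) + y) = c * y - x"
        using c0 by (simp add: algebra_simps)
      finally show ?thesis
        by (simp add: indicator_def norm_minus_commute)
    qed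
    then show "(\<integral>\<^sup>+x. ?i (- (x / c) + y) * f (c * y) \<partial>lborel) =
        (\<integral>\<^sup>+x. ?i (- (c * y) + x) \<partial>lborel) * f (c * y)"
      by (simp add: nn_integral_multc)
  qed
  also have "\<dots> = ennreal pi * (\<integral>\<^sup>+y. f (c * y) \<partial>lborel)"
    by (subst nn_integral_lborel_translate) (auto simp: I nn_integral_cmult)
  finally show ?thesis
    by (auto simp: ennreal_mult_cancel_left)
qed

lemma distr_lborel_rotate:
  assumes "norm (c::complex) = 1"
  shows "distr lborel borel ((*) c) = lborel"
proof (rule measure_eqI)
  fix A assume "A \<in> sets (distr lborel borel ((*) c))"
  then have A[measurable]: "A \<in> sets borel" by simp
  have "emeasure (distr lborel borel ((*) c)) A = (\<integral>\<^sup>+x. indicator A x \<partial>distr lborel borel ((*) c))"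
    by simp
  also have "\<dots> = (\<integral>\<^sup>+x. indicator A (c * x) \<partial>lborel)"
    by (rule nn_integral_distr) auto
  also have "\<dots> = emeasure lborel A"
    using nn_integral_lborel_rotate[of "indicator A" c] assms by simp
  finally show "emeasure (distr lborel borel ((*) c)) A = emeasure lborel A" .
qed simp

lemma integral_lborel_rotate:
  fixes F :: "complex \<Rightarrow> complex"
  assumes F: "integrable lborel F" and c: "norm c = 1"
  shows "(LINT z|lborel. F (c * z)) = (LINT z|lborel. F z)"
proof -
  have [measurable]: "F \<in> borel_measurable borel"
    using borel_measurable_integrable[OF F] by simp
  have "(LINT z|lborel. F z) = (LINT z|distr lborel borel ((*) c). F z)"
    by (simp add: distr_lborel_rotate[OF c])
  also have "\<dots> = (LINT z|lborel. F (c * z))"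
    by (rule integral_distr) auto
  finally show "(LINT z|lborel. F (c * z)) = (LINT z|lborel. F z)" ..
qed

text \<open>Fubini on [0,1] times the plane: for each fixed s the integral over z is independent of
  s by rotation invariance. The integrability conclusion later supplies measurability of the
  averaged function.\<close>

lemma
  fixes F :: "complex \<Rightarrow> complex"
  assumes F: "integrable lborel F"
  shows integrable_lborel_angular_average:
      "integrable lborel (\<lambda>z. (LINT s:{0..1}|lborel. F (exp (2 * of_real pi * \<i> * of_real s) * z)))"
    and integral_lborel_angular_average:
      "(LINT z|lborel. (LINT s:{0..1}|lborel. F (exp (2 * of_real pi * \<i> * of_real s) * z)))
        = (LINT z|lborel. F z)"
proof -
  define e where "e s = exp (2 * of_real pi * \<i> * of_real s)" for s :: real
  have ne: "norm (e s) = 1" for s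
    by (simp add: e_def)
  have [measurable]: "e \<in> borel_measurable borel"
    unfolding e_def by (intro borel_measurable_continuous_onI continuous_intros)
  have [measurable]: "F \<in> borel_measurable borel"
    using borel_measurable_integrable[OF F] by simp
  define H where "H s z = indicator {0..1::real} s *\<^sub>R F (e s * z)" for s z
  have [measurable]: "case_prod H \<in> borel_measurable (lborel \<Otimes>\<^sub>M lborel)"
    unfolding H_def by measurable
  have "(\<integral>\<^sup>+x. norm (case_prod H x) \<partial>(lborel \<Otimes>\<^sub>M lborel))
      = (\<integral>\<^sup>+s. \<integral>\<^sup>+z. norm (H s z) \<partial>lborel \<partial>lborel)"
    by (subst lborel.nn_integral_fst[symmetric]) auto
  also have "\<dots> = (\<integral>\<^sup>+s. (\<integral>\<^sup>+z. norm (F z) \<partial>lborel) * indicator {0..1::real} s \<partial>lborel)"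
  proof (rule nn_integral_cong)
    fix s
    have "(\<integral>\<^sup>+z. norm (F (e s * z)) \<partial>lborel) = (\<integral>\<^sup>+z. norm (F z) \<partial>lborel)"
      by (rule nn_integral_lborel_rotate) (auto simp: ne)
    then show "(\<integral>\<^sup>+z. norm (H s z) \<partial>lborel)
        = (\<integral>\<^sup>+z. norm (F z) \<partial>lborel) * indicator {0..1::real} s"
      by (simp add: H_def indicator_def)
  qed
  also have "\<dots> < \<infinity>"
    using F by (simp add: integrable_iff_bounded nn_integral_cmult_indicator)
  finally have H: "integrable (lborel \<Otimes>\<^sub>M lborel) (case_prod H)"
    by (intro integrableI_bounded) auto
  show "integrable lborel (\<lambda>z. (LINT s:{0..1}|lborel. F (exp (2 * of_real pi * \<i> * of_real s) * z)))"
    using lborel_pair.integrable_snd[OF H] by (simp add: H_def e_def set_lebesgue_integral_def)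
  have "(LINT z|lborel. (LINT s|lborel. H s z)) = (LINT s|lborel. (LINT z|lborel. H s z))"
    by (rule lborel_pair.Fubini_integral[OF H])
  also have "\<dots> = (LINT s|lborel. indicator {0..1::real} s *\<^sub>R (LINT z|lborel. F z))"
    by (simp add: H_def integral_lborel_rotate[OF F ne])
  also have "\<dots> = (LINT z|lborel. F z)"
    by simp
  finally show "(LINT z|lborel. (LINT s:{0..1}|lborel. F (exp (2 * of_real pi * \<i> * of_real s) * z)))
        = (LINT z|lborel. F z)"
    by (simp add: H_def e_def set_lebesgue_integral_def)
qed

section \<open>The Cauchy transform of a monomial on the disc\<close>

text \<open>With a = z/\<zeta> and e(s) on the unit circle, de = 2 pi i e ds, so the average of e/(e
  - a) is the winding number of the unit circle about a. The hypothesis keeps a off the circle. For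
  \<zeta> = 0 the integrand vanishes identically.\<close>

lemma circle_average_cauchy_kernel:
  assumes "norm z \<noteq> norm \<zeta>"
  shows "(LINT s:{0..1}|lborel. exp (2 * of_real pi * \<i> * of_real s) * \<zeta>
            / (exp (2 * of_real pi * \<i> * of_real s) * \<zeta> - z))
    = (if norm z < norm \<zeta> then 1 else 0)"
proof (cases "\<zeta> = 0")
  case False
  define e where "e s = exp (2 * of_real pi * \<i> * of_real s)" for s :: real
  have ne: "norm (e s) = 1" for s
    by (simp add: e_def)
  define a where "a = z / \<zeta>"
  have a1: "norm a \<noteq> 1" and a2: "norm a < 1 \<longleftrightarrow> norm z < norm \<zeta>"
    using False assms by (auto simp: a_def norm_divide field_simps)
  have ea: "e s - a \<noteq> 0" for s
    using ne[of s] a1 by auto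
  have cp: "circlepath 0 1 = e"
    by (auto simp: circlepath_def part_circlepath_def linepath_def e_def fun_eq_iff algebra_simps)
  have wn: "winding_number (circlepath 0 1) a = (if norm a < 1 then 1 else 0)"
  proof (cases "norm a < 1")
    case True
    then show ?thesis using winding_number_circlepath[of a 0 1] by simp
  next
    case False
    then have "winding_number (circlepath 0 1) a = 0"
      using a1 by (intro winding_number_zero_outside[where s = "cball 0 1"]) auto
    with False show ?thesis by simp
  qed
  have "((\<lambda>w. 1 / (w - a)) has_contour_integral
      2 * of_real pi * \<i> * winding_number (circlepath 0 1) a) (circlepath 0 1)"
    using has_contour_integral_winding_number[of "circlepath 0 1" a] a1 by simp
  then have "((\<lambda>s. 1 / (e s - a) * (2 * of_real pi * \<i> * e s)) has_integral
      2 * of_real pi * \<i> * (if norm a < 1 then 1 else 0)) {0..1}"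
    unfolding has_contour_integral_def wn
    by (rule has_integral_eq[rotated])
       (simp add: vector_derivative_circlepath01, simp add: cp e_def)
  from has_integral_mult_right[OF this, of "1 / (2 * of_real pi * \<i>)"]
  have "((\<lambda>s. e s / (e s - a)) has_integral (if norm a < 1 then 1 else 0)) {0..1}"
    by simp
  then have "integral {0..1} (\<lambda>s. e s / (e s - a)) = (if norm a < 1 then 1 else 0)"
    by (rule integral_unique)
  moreover have "set_integrable lborel {0..1} (\<lambda>s. e s / (e s - a))"
    unfolding e_def set_integrable_def
    by (rule borel_integrable_compact)
       (auto intro!: continuous_intros simp: ea[unfolded e_def, simplified])
  ultimately have "(LINT s:{0..1}|lborel. e s / (e s - a)) = (if norm a < 1 then 1 else 0)"
    by (simp add: set_borel_integral_eq_integral)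
  moreover have "e s / (e s - a) = e s * \<zeta> / (e s * \<zeta> - z)" for s
  proof -
    have "e s * \<zeta> - z = (e s - a) * \<zeta>"
      using False by (simp add: a_def left_diff_distrib)
    then show ?thesis using False by simp
  qed
  ultimately show ?thesis
    by (simp add: a2 e_def)
qed (use assms in auto)

text \<open>The numerator has modulus at most 1 on the disc, and the disc lies in the ball of radius
  2 about z, so 1/|\<zeta> - z| on that ball is an integrable majorant.\<close>

lemma set_integrable_cauchy_kernel_disc:
  assumes z: "norm z < 1"
  shows "set_integrable lborel \<D> (\<lambda>\<zeta>. of_real (norm \<zeta> ^ n) * (\<zeta> / (\<zeta> - z)))"
  unfolding set_integrable_def
proof (rule integrableI_bounded)
  have D: "\<D> \<in> sets lborel" by simp
  show "(\<lambda>\<zeta>. indicator \<D> \<zeta> *\<^sub>R (of_real (norm \<zeta> ^ n) * (\<zeta> / (\<zeta> - z)))) \<in> borel_measurable lborel"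
    using D by measurable
  have "(\<integral>\<^sup>+\<zeta>. ennreal (norm (indicator \<D> \<zeta> *\<^sub>R (of_real (norm \<zeta> ^ n) * (\<zeta> / (\<zeta> - z))))) \<partial>lborel)
      \<le> (\<integral>\<^sup>+\<zeta>. ennreal (1 / norm (- z + \<zeta>)) * indicator {..<2} (norm (- z + \<zeta>)) \<partial>lborel)"
  proof (rule nn_integral_mono)
    fix \<zeta> :: complex
    show "ennreal (norm (indicator \<D> \<zeta> *\<^sub>R (of_real (norm \<zeta> ^ n) * (\<zeta> / (\<zeta> - z)))))
        \<le> ennreal (1 / norm (- z + \<zeta>)) * indicator {..<2} (norm (- z + \<zeta>))"
    proof (cases "norm \<zeta> < 1")
      case True
      have "norm (- z + \<zeta>) < 2"
        using norm_triangle_ineq[of "- z" \<zeta>] True z by simp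
      moreover have "norm \<zeta> ^ n * norm \<zeta> \<le> 1 * 1"
        using True by (intro mult_mono power_le_one) auto
      then have "norm \<zeta> ^ n * norm \<zeta> / norm (\<zeta> - z) \<le> 1 / norm (\<zeta> - z)"
        by (intro divide_right_mono) auto
      ultimately show ?thesis
        using True by (simp add: norm_mult norm_divide norm_power)
    qed simp
  qed
  also have "\<dots> = (\<integral>\<^sup>+w. ennreal (1 / norm w) * indicator {..<2} (norm w) \<partial>(lborel :: complex measure))"
    by (rule nn_integral_lborel_translate) measurable
  also have "\<dots> = (\<integral>\<^sup>+w\<in>ball 0 2. ennreal (1 / norm w) \<partial>(lborel :: complex measure))"
    by (auto intro!: nn_integral_cong simp: indicator_def)
  also have "\<dots> < \<infinity>"
    by (rule nn_integral_inverse_norm_ball_finite)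
  finally show "(\<integral>\<^sup>+\<zeta>. ennreal (norm (indicator \<D> \<zeta> *\<^sub>R (of_real (norm \<zeta> ^ n) * (\<zeta> / (\<zeta> - z))))) \<partial>lborel) < \<infinity>" .
qed

text \<open>Replacing the integrand by its angular average leaves |\<zeta>|^n on the annulus |z| <
  |\<zeta>| < 1 and 0 elsewhere, a radial integral.\<close>

lemma integral_cauchy_kernel_disc:
  assumes z: "norm z < 1"
  shows "(LINT \<zeta>:\<D>|lborel. of_real (norm \<zeta> ^ n) * (\<zeta> / (\<zeta> - z)))
    = of_real (2 * pi * (1 - norm z ^ (n + 2)) / real (n + 2))"
proof -
  define A where "A = {w::complex. norm z < norm w \<and> norm w < 1}"
  define F where "F \<zeta> = indicator \<D> \<zeta> *\<^sub>R (of_real (norm \<zeta> ^ n) * (\<zeta> / (\<zeta> - z)))" for \<zeta>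
  have [measurable]: "A \<in> sets borel"
    unfolding A_def by measurable
  have nn: "(\<integral>\<^sup>+w\<in>A. ennreal (norm w ^ n) \<partial>lborel)
      = ennreal (2 * pi * (1 - norm z ^ (n + 2)) / real (n + 2))"
    using nn_integral_radial_annulus[of "norm z" 1 n] z by (simp add: A_def)
  have pos: "0 \<le> 2 * pi * (1 - norm z ^ (n + 2)) / real (n + 2)"
    using z by (intro divide_nonneg_nonneg mult_nonneg_nonneg)
               (auto simp del: power_Suc add_2_eq_Suc' intro: power_le_one)
  \<comment> \<open>On the circle through z the rotated kernel meets its pole; that circle is
    null.\<close>
  have "AE \<zeta>::complex in lborel. norm \<zeta> \<noteq> norm z"
  proof (rule AE_I')
    have "negligible (sphere (0::complex) (norm z))"
      by (rule negligible_sphere)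
    then show "sphere (0::complex) (norm z) \<in> null_sets lborel"
      by (auto simp: negligible_iff_null_sets null_sets_completion_iff)
  qed auto
  then have AE: "AE \<zeta> in lborel. (LINT s:{0..1}|lborel. F (exp (2 * of_real pi * \<i> * of_real s) * \<zeta>))
      = of_real (indicator A \<zeta> * norm \<zeta> ^ n)"
  proof eventually_elim
    fix \<zeta> :: complex assume "norm \<zeta> \<noteq> norm z"
    then have *: "norm z \<noteq> norm \<zeta>" by simp
    \<comment> \<open>The indicator and |\<zeta>|^n are unchanged by rotation and factor out, so
      only \<zeta>/(\<zeta> - z) is averaged.\<close>
    have "(LINT s:{0..1}|lborel. F (exp (2 * of_real pi * \<i> * of_real s) * \<zeta>))
      = (LINT s:{0..1}|lborel. (indicator \<D> \<zeta> * of_real (norm \<zeta> ^ n)) *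
          (exp (2 * of_real pi * \<i> * of_real s) * \<zeta>
            / (exp (2 * of_real pi * \<i> * of_real s) * \<zeta> - z)))"
      by (simp add: F_def norm_mult indicator_def)
    also have "\<dots> = (indicator \<D> \<zeta> * of_real (norm \<zeta> ^ n)) * (if norm z < norm \<zeta> then 1 else 0)"
      by (simp only: set_integral_mult_right circle_average_cauchy_kernel[OF *])
    finally show "(LINT s:{0..1}|lborel. F (exp (2 * of_real pi * \<i> * of_real s) * \<zeta>))
      = of_real (indicator A \<zeta> * norm \<zeta> ^ n)"
      by (simp add: A_def indicator_def)
  qed
  have intF: "integrable lborel F"
    using set_integrable_cauchy_kernel_disc[OF z, of n] by (simp add: F_def[abs_def] set_integrable_def)
  have "(LINT \<zeta>:\<D>|lborel. of_real (norm \<zeta> ^ n) * (\<zeta> / (\<zeta> - z))) = (LINT \<zeta>|lborel. F \<zeta>)"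
    by (simp add: F_def set_lebesgue_integral_def)
  also have "\<dots> = (LINT \<zeta>|lborel. of_real (indicator A \<zeta> * norm \<zeta> ^ n))"
    unfolding integral_lborel_angular_average[OF intF, symmetric]
    using integrable_lborel_angular_average[OF intF]
    by (intro integral_cong_AE AE) (auto dest: borel_measurable_integrable)
  also have "\<dots> = of_real (LINT \<zeta>|lborel. indicator A \<zeta> * norm \<zeta> ^ n)"
    by (rule integral_complex_of_real)
  also have "(LINT \<zeta>|lborel. indicator A \<zeta> * norm \<zeta> ^ n)
      = enn2real (\<integral>\<^sup>+w\<in>A. ennreal (norm w ^ n) \<partial>lborel)"
    by (subst integral_eq_nn_integral)
       (auto intro!: arg_cong[where f = enn2real] nn_integral_cong simp: indicator_def)
  also have "\<dots> = 2 * pi * (1 - norm z ^ (n + 2)) / real (n + 2)"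
    unfolding nn using pos by (rule enn2real_ennreal)
  finally show ?thesis .
qed

lemma cnj_power_mult_power: "cnj w ^ k * w ^ k = of_real (norm w ^ (2 * k))"
proof -
  have "cnj w ^ k * w ^ k = (w * cnj w) ^ k"
    by (simp add: power_mult_distrib mult.commute)
  also have "\<dots> = of_real (norm w ^ (2 * k))"
    by (simp add: complex_norm_square[symmetric] power_mult)
  finally show ?thesis .
qed

text \<open>For k \<ge> 1 the numerator is |\<zeta>|^(2k-2) \<zeta>, so the kernel integral applies
  with n = 2k - 2; its factor 2 pi/(n + 2) becomes pi/k.\<close>

lemma
  assumes "norm z < 1" "k \<ge> 1"
  shows set_integrable_cauchy_monomial_disc:
      "set_integrable lborel \<D> (\<lambda>\<zeta>. cnj \<zeta> ^ (k - 1) * \<zeta> ^ k / (\<zeta> - z))"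
    and integral_cauchy_monomial_disc:
      "(LINT \<zeta>:\<D>|lborel. cnj \<zeta> ^ (k - 1) * \<zeta> ^ k / (\<zeta> - z))
        = of_real (pi * (1 - norm z ^ (2 * k)) / real k)"
proof -
  have k: "2 * k - 2 + 2 = 2 * k"
    using assms by simp
  have eq: "cnj \<zeta> ^ (k - 1) * \<zeta> ^ k / (\<zeta> - z)
      = of_real (norm \<zeta> ^ (2 * k - 2)) * (\<zeta> / (\<zeta> - z))" for \<zeta>
  proof -
    obtain m where "k = Suc m"
      using assms by (cases k) auto
    then show ?thesis
      using cnj_power_mult_power[of \<zeta> m] by (simp add: mult_ac)
  qed
  show "set_integrable lborel \<D> (\<lambda>\<zeta>. cnj \<zeta> ^ (k - 1) * \<zeta> ^ k / (\<zeta> - z))"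
    unfolding eq by (rule set_integrable_cauchy_kernel_disc[OF assms(1)])
  show "(LINT \<zeta>:\<D>|lborel. cnj \<zeta> ^ (k - 1) * \<zeta> ^ k / (\<zeta> - z))
        = of_real (pi * (1 - norm z ^ (2 * k)) / real k)"
    unfolding eq integral_cauchy_kernel_disc[OF assms(1)] k by simp
qed

section \<open>Integrals of products and finite sums\<close>

text \<open>Fubini for separated variables: the iterated integral of the modulus factorises and is
  finite. This reduces the integral over the bidisc in T to two one-variable transforms.\<close>

lemma
  fixes f :: "'a::euclidean_space \<Rightarrow> complex" and g :: "'b::euclidean_space \<Rightarrow> complex"
  assumes f: "set_integrable lborel A f" and g: "set_integrable lborel B g"
  shows set_integrable_lborel_product:
      "set_integrable lborel (A \<times> B) (\<lambda>x. f (fst x) * g (snd x))"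
    and set_integral_lborel_product:
      "(LINT x:A \<times> B|lborel. f (fst x) * g (snd x))
        = (LINT x:A|lborel. f x) * (LINT y:B|lborel. g y)"
proof -
  define F where "F x = indicator A x *\<^sub>R f x" for x
  define G where "G y = indicator B y *\<^sub>R g y" for y
  have F: "integrable lborel F" and G: "integrable lborel G"
    using f g by (simp_all add: F_def[abs_def] G_def[abs_def] set_integrable_def)
  have [measurable]: "F \<in> borel_measurable borel" "G \<in> borel_measurable borel"
    using borel_measurable_integrable[OF F] borel_measurable_integrable[OF G] by simp_all
  have eq: "indicator (A \<times> B) x *\<^sub>R (f (fst x) * g (snd x)) = F (fst x) * G (snd x)" for x
    by (cases x) (auto simp: F_def G_def indicator_def)
  have FG: "integrable (lborel \<Otimes>\<^sub>M lborel) (\<lambda>x. F (fst x) * G (snd x))"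
  proof (rule lborel_pair.Fubini_integrable)
    show "integrable lborel (\<lambda>x. LINT y|lborel. norm (F (fst (x, y)) * G (snd (x, y))))"
      using F by (simp add: norm_mult)
    show "AE x in lborel. integrable lborel (\<lambda>y. F (fst (x, y)) * G (snd (x, y)))"
      using G by simp
  qed measurable
  then show "set_integrable lborel (A \<times> B) (\<lambda>x. f (fst x) * g (snd x))"
    by (simp add: set_integrable_def eq lborel_prod)
  have "(LINT x:A \<times> B|lborel. f (fst x) * g (snd x))
      = (LINT x|(lborel \<Otimes>\<^sub>M lborel). F (fst x) * G (snd x))"
    by (simp add: set_lebesgue_integral_def eq lborel_prod)
  also have "\<dots> = (LINT x|lborel. (LINT y|lborel. F (fst (x, y)) * G (snd (x, y))))"
    by (rule lborel_pair.integral_fst'[OF FG, symmetric])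
  also have "\<dots> = (LINT x|lborel. F x) * (LINT y|lborel. G y)"
    by simp
  finally show "(LINT x:A \<times> B|lborel. f (fst x) * g (snd x))
        = (LINT x:A|lborel. f x) * (LINT y:B|lborel. g y)"
    by (simp add: F_def G_def set_lebesgue_integral_def)
qed

lemma set_integral_sum_mult:
  fixes f :: "'i \<Rightarrow> 'a \<Rightarrow> complex"
  assumes "\<And>k. k \<in> I \<Longrightarrow> set_integrable M A (f k)"
  shows "(LINT x:A|M. (\<Sum>k\<in>I. c k * f k x)) = (\<Sum>k\<in>I. c k * (LINT x:A|M. f k x))"
proof -
  have "(LINT x:A|M. (\<Sum>k\<in>I. c k * f k x)) = (LINT x|M. (\<Sum>k\<in>I. c k * (indicator A x *\<^sub>R f k x)))"
    by (simp add: set_lebesgue_integral_def scaleR_sum_right)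
  also have "\<dots> = (\<Sum>k\<in>I. (LINT x|M. c k * (indicator A x *\<^sub>R f k x)))"
    using assms unfolding set_integrable_def
    by (intro Bochner_Integration.integral_sum integrable_mult_right)
  also have "\<dots> = (\<Sum>k\<in>I. c k * (LINT x|M. indicator A x *\<^sub>R f k x))"
    by (simp only: integral_mult_right_zero)
  finally show ?thesis
    by (simp only: set_lebesgue_integral_def)
qed

section \<open>Wirtinger derivatives and closedness of the forms\<close>

text \<open>Conjugation is not complex differentiable, but for real t the conjugate of z + u t is
  cnj z + cnj u * t. The function is thus the restriction of a polynomial in complex t. When an
  exponent is 0, the truncated exponent \<open>p - 1\<close> or \<open>q - 1\<close> is multiplied
  by 0.\<close>

lemma has_vector_derivative_cnj_power_mult_power:
  "((\<lambda>t::real. cnj (z + u * of_real t) ^ p * (z + u * of_real t) ^ q) has_vector_derivative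
      cnj u * (of_nat p * cnj z ^ (p - 1) * z ^ q) + u * (of_nat q * cnj z ^ p * z ^ (q - 1))) (at 0)"
proof -
  have "((\<lambda>t::complex. (cnj z + cnj u * t) ^ p * (z + u * t) ^ q) has_field_derivative
      cnj u * (of_nat p * cnj z ^ (p - 1) * z ^ q) + u * (of_nat q * cnj z ^ p * z ^ (q - 1)))
        (at (of_real 0))"
    by (auto intro!: derivative_eq_intros simp: algebra_simps)
  from has_vector_derivative_real_field[OF this] show ?thesis
    by simp
qed

lemma wirtinger_bar_sum_monomials:
  "wirtinger_bar (\<lambda>w. \<Sum>k\<in>I. c k * (cnj w ^ p k * w ^ q k)) z
    = (\<Sum>k\<in>I. c k * (of_nat (p k) * cnj z ^ (p k - 1) * z ^ q k))"
proof -
  define P where "P k = of_nat (p k) * cnj z ^ (p k - 1) * z ^ q k" for k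
  define Q where "Q k = of_nat (q k) * cnj z ^ p k * z ^ (q k - 1)" for k
  have D: "vector_derivative (\<lambda>t::real. \<Sum>k\<in>I. c k *
        (cnj (z + u * of_real t) ^ p k * (z + u * of_real t) ^ q k)) (at 0)
      = (\<Sum>k\<in>I. c k * (cnj u * P k + u * Q k))" for u
    unfolding P_def Q_def
    by (intro vector_derivative_at has_vector_derivative_sum has_vector_derivative_mult_right
        has_vector_derivative_cnj_power_mult_power)
  \<comment> \<open>The directions u = 1 and u = i give P + Q and -i P + i Q, so adding i times the
    second to the first cancels Q and doubles P.\<close>
  have "wirtinger_bar (\<lambda>w. \<Sum>k\<in>I. c k * (cnj w ^ p k * w ^ q k)) z
      = ((\<Sum>k\<in>I. c k * (P k + Q k)) + \<i> * (\<Sum>k\<in>I. c k * (- \<i> * P k + \<i> * Q k))) / 2"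
    using D[of 1] D[of \<i>] by (simp add: wirtinger_bar_def)
  also have "\<dots> = (\<Sum>k\<in>I. c k * P k)"
    by (simp add: sum_distrib_left sum.distrib[symmetric] sum_divide_distrib)
       (simp add: algebra_simps)
  finally show ?thesis
    by (simp add: P_def)
qed

lemma mixed_deriv_g_form:
  "\<DD> (g_form L) (z1, z2)
    = (\<Sum>k=1..L. of_nat k * ((cnj z1 ^ (k - 1) * z1 ^ k) * (cnj z2 ^ (k - 1) * z2 ^ k)))"
  using wirtinger_bar_sum_monomials[of "\<lambda>k. cnj z1 ^ (k - 1) * z1 ^ k" "\<lambda>k. k" "\<lambda>k. k" "{1..L}" z2]
  by (simp add: mixed_deriv_def g_form_def wirtinger_bar2_def mult_ac)

text \<open>Both mixed derivatives equal the same sum, which is symmetric in z1 and z2.\<close>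

lemma dbar_g_form: "dbar (g_form L) z = 0"
proof -
  obtain z1 z2 where z: "z = (z1, z2)"
    by (cases z)
  have "wirtinger_bar1 (snd (g_form L)) (z1, z2)
    = (\<Sum>k=1..L. of_nat k * ((cnj z1 ^ (k - 1) * z1 ^ k) * (cnj z2 ^ (k - 1) * z2 ^ k)))"
    using wirtinger_bar_sum_monomials[of "\<lambda>k. cnj z2 ^ (k - 1) * z2 ^ k" "\<lambda>k. k" "\<lambda>k. k" "{1..L}" z1]
    by (simp add: g_form_def wirtinger_bar1_def mult_ac)
  with mixed_deriv_g_form[of L z1 z2] show ?thesis
    by (simp add: z dbar_def mixed_deriv_def g_form_def)
qed

section \<open>Exact evaluation of T on the forms\<close>

lemma T_op_g_form:
  assumes z: "norm z1 < 1" "norm z2 < 1"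
  shows "T_op (g_form L) (z1, z2)
    = of_real (\<Sum>k=1..L. (norm z1 ^ (2 * k) * norm z2 ^ (2 * k) - 1) / real k)"
proof -
  \<comment> \<open>All three integrands of T are combinations of this kernel: its coefficients are
    a k or b k in the single integrals, and the factor k from \<open>\<DD>\<close> in the double
    one.\<close>
  define K where "K k w \<zeta> = cnj \<zeta> ^ (k - 1) * \<zeta> ^ k / (\<zeta> - w)" for k and w \<zeta> :: complex
  define a b where "a k = complex_of_real (norm z1 ^ (2 * k))"
    and "b k = complex_of_real (norm z2 ^ (2 * k))" for k
  have ab: "cnj z1 ^ k * z1 ^ k = a k" "cnj z2 ^ k * z2 ^ k = b k" for k
    by (simp_all add: a_def b_def cnj_power_mult_power)
  have Kint: "set_integrable lborel \<D> (K k w)" if "norm w < 1" "k \<in> {1..L}" for k w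
    using set_integrable_cauchy_monomial_disc[of w k] that by (simp add: K_def[abs_def])
  have K1: "(LINT \<zeta>:\<D>|lborel. K k z1 \<zeta>) = of_real pi * (1 - a k) / of_nat k" if "k \<in> {1..L}" for k
    using integral_cauchy_monomial_disc[of z1 k] that z by (simp add: K_def[abs_def] a_def)
  have K2: "(LINT \<zeta>:\<D>|lborel. K k z2 \<zeta>) = of_real pi * (1 - b k) / of_nat k" if "k \<in> {1..L}" for k
    using integral_cauchy_monomial_disc[of z2 k] that z by (simp add: K_def[abs_def] b_def)
  have I2: "(LINT \<zeta>2:\<D>|lborel. snd (g_form L) (z1, \<zeta>2) / (\<zeta>2 - z2) * (2 * \<i>))
      = (\<Sum>k=1..L. (2 * \<i> * a k) * (of_real pi * (1 - b k) / of_nat k))"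
  proof -
    have "snd (g_form L) (z1, \<zeta>2) / (\<zeta>2 - z2) * (2 * \<i>) = (\<Sum>k=1..L. (2 * \<i> * a k) * K k z2 \<zeta>2)" for \<zeta>2
      by (simp add: g_form_def ab[symmetric] K_def sum_divide_distrib sum_distrib_left sum_distrib_right mult_ac)
    then have "(LINT \<zeta>2:\<D>|lborel. snd (g_form L) (z1, \<zeta>2) / (\<zeta>2 - z2) * (2 * \<i>))
        = (LINT \<zeta>2:\<D>|lborel. (\<Sum>k=1..L. (2 * \<i> * a k) * K k z2 \<zeta>2))"
      by simp
    also have "\<dots> = (\<Sum>k=1..L. (2 * \<i> * a k) * (LINT \<zeta>:\<D>|lborel. K k z2 \<zeta>))"
      by (rule set_integral_sum_mult) (use Kint z in auto)
    finally show ?thesis by (simp add: K2)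
  qed
  have I1: "(LINT \<zeta>1:\<D>|lborel. fst (g_form L) (\<zeta>1, z2) / (\<zeta>1 - z1) * (2 * \<i>))
      = (\<Sum>k=1..L. (2 * \<i> * b k) * (of_real pi * (1 - a k) / of_nat k))"
  proof -
    have "fst (g_form L) (\<zeta>1, z2) / (\<zeta>1 - z1) * (2 * \<i>) = (\<Sum>k=1..L. (2 * \<i> * b k) * K k z1 \<zeta>1)" for \<zeta>1
      by (simp add: g_form_def ab[symmetric] K_def sum_divide_distrib sum_distrib_left sum_distrib_right mult_ac)
    then have "(LINT \<zeta>1:\<D>|lborel. fst (g_form L) (\<zeta>1, z2) / (\<zeta>1 - z1) * (2 * \<i>))
        = (LINT \<zeta>1:\<D>|lborel. (\<Sum>k=1..L. (2 * \<i> * b k) * K k z1 \<zeta>1))"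
      by simp
    also have "\<dots> = (\<Sum>k=1..L. (2 * \<i> * b k) * (LINT \<zeta>:\<D>|lborel. K k z1 \<zeta>))"
      by (rule set_integral_sum_mult) (use Kint z in auto)
    finally show ?thesis by (simp add: K1)
  qed
  have I12: "(LINT \<zeta>:\<D>\<^sup>2|lborel. \<DD> (g_form L) \<zeta> / ((fst \<zeta> - z1) * (snd \<zeta> - z2)) * (2 * \<i>)\<^sup>2)
      = (\<Sum>k=1..L. ((2 * \<i>)\<^sup>2 * of_nat k) *
          ((of_real pi * (1 - a k) / of_nat k) * (of_real pi * (1 - b k) / of_nat k)))"
  proof -
    have "\<DD> (g_form L) \<zeta> / ((fst \<zeta> - z1) * (snd \<zeta> - z2)) * (2 * \<i>)\<^sup>2
        = (\<Sum>k=1..L. ((2 * \<i>)\<^sup>2 * of_nat k) * (K k z1 (fst \<zeta>) * K k z2 (snd \<zeta>)))" for \<zeta>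
      by (cases \<zeta>) (simp add: mixed_deriv_g_form K_def sum_divide_distrib sum_distrib_left sum_distrib_right mult_ac)
    then have "(LINT \<zeta>:\<D>\<^sup>2|lborel. \<DD> (g_form L) \<zeta> / ((fst \<zeta> - z1) * (snd \<zeta> - z2)) * (2 * \<i>)\<^sup>2)
        = (LINT \<zeta>:\<D>\<^sup>2|lborel. (\<Sum>k=1..L. ((2 * \<i>)\<^sup>2 * of_nat k) * (K k z1 (fst \<zeta>) * K k z2 (snd \<zeta>))))"
      by simp
    also have "\<dots> = (\<Sum>k=1..L. ((2 * \<i>)\<^sup>2 * of_nat k) *
        (LINT \<zeta>:\<D>\<^sup>2|lborel. K k z1 (fst \<zeta>) * K k z2 (snd \<zeta>)))"
      by (rule set_integral_sum_mult) (use Kint z in \<open>auto intro!: set_integrable_lborel_product\<close>)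
    also have "\<dots> = (\<Sum>k=1..L. ((2 * \<i>)\<^sup>2 * of_nat k) *
        ((LINT \<zeta>:\<D>|lborel. K k z1 \<zeta>) * (LINT \<zeta>:\<D>|lborel. K k z2 \<zeta>)))"
      using Kint z by (intro sum.cong refl arg_cong2[where f = "(*)"] set_integral_lborel_product) auto
    finally show ?thesis by (simp add: K1 K2)
  qed
  have "T_op (g_form L) (z1, z2)
      = (-1) / (2 * of_real pi * \<i>) * (\<Sum>k=1..L. (2 * \<i> * a k) * (of_real pi * (1 - b k) / of_nat k))
      + (-1) / (2 * of_real pi * \<i>) * (\<Sum>k=1..L. (2 * \<i> * b k) * (of_real pi * (1 - a k) / of_nat k))
      + (-1) / (2 * of_real pi * \<i>)\<^sup>2 * (\<Sum>k=1..L. ((2 * \<i>)\<^sup>2 * of_nat k) *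
          ((of_real pi * (1 - a k) / of_nat k) * (of_real pi * (1 - b k) / of_nat k)))"
    unfolding I1[symmetric] I2[symmetric] I12[symmetric]
    by (simp add: T_op_def case_prod_beta)
  also have "\<dots> = (\<Sum>k=1..L. (a k * b k - 1) / of_nat k)"
    unfolding sum_distrib_left sum.distrib[symmetric]
  proof (rule sum.cong[OF refl])
    fix k assume "k \<in> {1..L}"
    then have k: "of_nat k \<noteq> (0::complex)" by simp
    \<comment> \<open>The constants cancel pi exactly, leaving -a(1 - b)/k, -b(1 - a)/k and -(1 -
      a)(1 - b)/k; in the last, k/k^2 has become 1/k.\<close>
    show "(-1) / (2 * of_real pi * \<i>) * ((2 * \<i> * a k) * (of_real pi * (1 - b k) / of_nat k))
      + (-1) / (2 * of_real pi * \<i>) * ((2 * \<i> * b k) * (of_real pi * (1 - a k) / of_nat k))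
      + (-1) / (2 * of_real pi * \<i>)\<^sup>2 * (((2 * \<i>)\<^sup>2 * of_nat k) *
          ((of_real pi * (1 - a k) / of_nat k) * (of_real pi * (1 - b k) / of_nat k)))
      = (a k * b k - 1) / of_nat k"
      using k by (simp add: power_mult_distrib divide_simps) (simp add: algebra_simps power2_eq_square)
  qed
  finally show ?thesis
    by (simp add: a_def b_def)
qed

section \<open>Uniform L1 bound for the forms\<close>

text \<open>The disc is the annulus with inner radius 0 together with the origin, where the
  integrand vanishes because n > 0.\<close>

lemma nn_integral_norm_power_disc:
  assumes "n > 0"
  shows "(\<integral>\<^sup>+w\<in>\<D>. ennreal (norm w ^ n) \<partial>lborel) = ennreal (2 * pi / real (n + 2))"
proof -
  have "(\<integral>\<^sup>+w\<in>\<D>. ennreal (norm w ^ n) \<partial>lborel)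
      = (\<integral>\<^sup>+w\<in>{w. 0 < norm w \<and> norm w < 1}. ennreal (norm w ^ n) \<partial>(lborel :: complex measure))"
    using assms by (intro nn_integral_cong) (auto simp: indicator_def zero_power)
  then show ?thesis
    using nn_integral_radial_annulus[of 0 1 n] by simp
qed

lemma nn_integral_lborel_product:
  fixes f :: "'a::euclidean_space \<Rightarrow> ennreal" and g :: "'b::euclidean_space \<Rightarrow> ennreal"
  assumes [measurable]: "f \<in> borel_measurable borel" "g \<in> borel_measurable borel"
    "A \<in> sets borel" "B \<in> sets borel"
  shows "(\<integral>\<^sup>+x\<in>A \<times> B. f (fst x) * g (snd x) \<partial>lborel)
    = (\<integral>\<^sup>+x\<in>A. f x \<partial>lborel) * (\<integral>\<^sup>+y\<in>B. g y \<partial>lborel)"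
proof -
  have "(\<integral>\<^sup>+x\<in>A \<times> B. f (fst x) * g (snd x) \<partial>lborel)
      = (\<integral>\<^sup>+x. (f (fst x) * indicator A (fst x)) * (g (snd x) * indicator B (snd x))
          \<partial>(lborel \<Otimes>\<^sub>M lborel))"
    unfolding lborel_prod by (intro nn_integral_cong) (auto simp: indicator_def)
  also have "\<dots> = (\<integral>\<^sup>+x. \<integral>\<^sup>+y. (f x * indicator A x) * (g y * indicator B y) \<partial>lborel \<partial>lborel)"
    by (subst lborel.nn_integral_fst[symmetric]) auto
  also have "\<dots> = (\<integral>\<^sup>+x\<in>A. f x \<partial>lborel) * (\<integral>\<^sup>+y\<in>B. g y \<partial>lborel)"
    by (simp add: nn_integral_cmult nn_integral_multc)
  finally show ?thesis .
qed

text \<open>The sum telescopes to 1 - 1/(n + 1).\<close>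

lemma sum_inverse_consecutive_le_1: "(\<Sum>k=1..n. 1 / (real k * real (k + 1))) \<le> 1"
proof -
  have "(\<Sum>k=1..n. 1 / (real k * real (k + 1))) = 1 - 1 / real (n + 1)"
  proof (induction n)
    case (Suc n)
    have "(\<Sum>k=1..Suc n. 1 / (real k * real (k + 1)))
        = 1 - 1 / real (n + 1) + 1 / (real (Suc n) * real (Suc n + 1))"
      unfolding Suc.IH[symmetric] by simp
    also have "\<dots> = 1 - 1 / real (Suc n + 1)"
      by (simp add: divide_simps) (simp add: algebra_simps)
    finally show ?case .
  qed simp
  then show ?thesis by simp
qed

text \<open>The conditions on p and q cover the exponent pairs (2k - 1, 2k) and (2k, 2k - 1) of the
  two coefficients at once, written without truncated subtraction. Each summand integrates to 4
  pi^2/((p + 2)(q + 2)) \<le> pi^2/(k(k + 1)), and the resulting series telescopes.\<close>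

lemma L1_norm_le_monomial_sum:
  assumes h: "\<And>z. z \<in> \<D>\<^sup>2 \<Longrightarrow> norm (h z) \<le> (\<Sum>k=1..L. norm (fst z) ^ p k * norm (snd z) ^ q k)"
    and pq: "\<And>k. k \<ge> 1 \<Longrightarrow> 2 * k \<le> p k + 1 \<and> 2 * k \<le> q k + 1 \<and> 4 * k \<le> p k + q k + 1"
  shows "L1_norm h \<le> ennreal (pi\<^sup>2)"
proof -
  have pos: "p k > 0" "q k > 0" if "k \<in> {1..L}" for k
    using pq[of k] that by auto
  have "L1_norm h \<le> (\<integral>\<^sup>+z. (\<Sum>k=1..L.
      ennreal (norm (fst z) ^ p k) * ennreal (norm (snd z) ^ q k) * indicator \<D>\<^sup>2 z) \<partial>lborel)"
    unfolding L1_norm_def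
  proof (rule nn_integral_mono)
    fix z :: "complex \<times> complex"
    show "ennreal (norm (h z)) * indicator \<D>\<^sup>2 z
      \<le> (\<Sum>k=1..L. ennreal (norm (fst z) ^ p k) * ennreal (norm (snd z) ^ q k) * indicator \<D>\<^sup>2 z)"
    proof (cases "z \<in> \<D>\<^sup>2")
      case True
      from h[OF True] have "ennreal (norm (h z))
          \<le> ennreal (\<Sum>k=1..L. norm (fst z) ^ p k * norm (snd z) ^ q k)"
        by (rule ennreal_leI)
      also have "\<dots> = (\<Sum>k=1..L. ennreal (norm (fst z) ^ p k) * ennreal (norm (snd z) ^ q k))"
        by (subst sum_ennreal[symmetric]) (auto simp: ennreal_mult)
      finally show ?thesis
        using True by simp
    qed simp
  qed
  also have "\<dots> = (\<Sum>k=1..L. (\<integral>\<^sup>+z\<in>\<D>\<^sup>2.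
      ennreal (norm (fst z) ^ p k) * ennreal (norm (snd z) ^ q k) \<partial>lborel))"
  proof (rule nn_integral_sum)
    fix k
    show "(\<lambda>z. ennreal (norm (fst z) ^ p k) * ennreal (norm (snd z) ^ q k) * indicator \<D>\<^sup>2 z)
        \<in> borel_measurable lborel"
      unfolding measurable_lborel2
      by (intro borel_measurable_times_ennreal borel_measurable_indicator borel_open open_Times
          measurable_compose[OF _ measurable_ennreal] borel_measurable_continuous_onI continuous_intros)
         auto
  qed
  also have "\<dots> = (\<Sum>k=1..L. ennreal (2 * pi / real (p k + 2)) * ennreal (2 * pi / real (q k + 2)))"
  proof (rule sum.cong[OF refl])
    fix k assume "k \<in> {1..L}"
    from pos[OF this] nn_integral_norm_power_disc
    show "(\<integral>\<^sup>+z\<in>\<D>\<^sup>2. ennreal (norm (fst z) ^ p k) * ennreal (norm (snd z) ^ q k) \<partial>lborel)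
        = ennreal (2 * pi / real (p k + 2)) * ennreal (2 * pi / real (q k + 2))"
      by (subst nn_integral_lborel_product) auto
  qed
  also have "\<dots> \<le> (\<Sum>k=1..L. ennreal (pi\<^sup>2 * (1 / (real k * real (k + 1)))))"
  proof (rule sum_mono)
    fix k assume "k \<in> {1..L}"
    then have k: "k \<ge> 1" by simp
    \<comment> \<open>The factor 2k + 2 goes to whichever exponent reaches 2k: if q does not, then q
      = 2k - 1 and the condition on p + q forces p \<ge> 2k.\<close>
    have "(2 * k + 1) * (2 * k + 2) \<le> (p k + 2) * (q k + 2)"
    proof (cases "q k \<ge> 2 * k")
      case True
      then show ?thesis using pq[OF k] by (intro mult_mono) auto
    next
      case False
      then have "(2 * k + 2) * (2 * k + 1) \<le> (p k + 2) * (q k + 2)"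
        using pq[OF k] by (intro mult_mono) auto
      then show ?thesis by (simp only: mult.commute)
    qed
    then have le: "4 * (k * (k + 1)) \<le> (p k + 2) * (q k + 2)"
      by (simp add: algebra_simps)
    have "2 * pi / real (p k + 2) * (2 * pi / real (q k + 2))
        = 4 * pi\<^sup>2 / real ((p k + 2) * (q k + 2))"
      by (simp only: of_nat_mult power2_eq_square times_divide_times_eq)
    also have "\<dots> \<le> 4 * pi\<^sup>2 / real (4 * (k * (k + 1)))"
      using le k by (intro divide_left_mono) (auto simp del: of_nat_mult of_nat_add)
    also have "\<dots> = pi\<^sup>2 * (1 / (real k * real (k + 1)))"
      by (simp only: of_nat_mult of_nat_numeral times_divide_eq_right mult_1_right
          mult_divide_mult_cancel_left[OF zero_neq_numeral[symmetric]])
    finally show "ennreal (2 * pi / real (p k + 2)) * ennreal (2 * pi / real (q k + 2))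
        \<le> ennreal (pi\<^sup>2 * (1 / (real k * real (k + 1))))"
      by (subst ennreal_mult[symmetric]) (auto intro: ennreal_leI)
  qed
  also have "\<dots> = ennreal (pi\<^sup>2 * (\<Sum>k=1..L. 1 / (real k * real (k + 1))))"
    by (subst sum_ennreal) (auto simp: sum_distrib_left)
  also have "\<dots> \<le> ennreal (pi\<^sup>2 * 1)"
    using sum_inverse_consecutive_le_1 by (intro ennreal_leI mult_left_mono) auto
  finally show ?thesis by simp
qed

lemma L1_norm_form_g_form_le: "L1_norm_form (g_form L) \<le> ennreal (2 * pi\<^sup>2)"
proof -
  have "L1_norm (fst (g_form L)) \<le> ennreal (pi\<^sup>2)"
  proof (rule L1_norm_le_monomial_sum)
    fix z
    have "norm (fst (g_form L) z)
        \<le> (\<Sum>k=1..L. norm (cnj (fst z) ^ (k - 1) * fst z ^ k * cnj (snd z) ^ k * snd z ^ k))"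
      by (simp add: g_form_def case_prod_beta norm_sum)
    also have "\<dots> = (\<Sum>k=1..L. norm (fst z) ^ (k - 1 + k) * norm (snd z) ^ (k + k))"
      by (simp only: norm_mult norm_power complex_mod_cnj power_add mult.assoc)
    finally show "norm (fst (g_form L) z)
        \<le> (\<Sum>k=1..L. norm (fst z) ^ (k - 1 + k) * norm (snd z) ^ (k + k))" .
  qed auto
  moreover have "L1_norm (snd (g_form L)) \<le> ennreal (pi\<^sup>2)"
  proof (rule L1_norm_le_monomial_sum)
    fix z
    have "norm (snd (g_form L) z)
        \<le> (\<Sum>k=1..L. norm (cnj (fst z) ^ k * fst z ^ k * cnj (snd z) ^ (k - 1) * snd z ^ k))"
      by (simp add: g_form_def case_prod_beta norm_sum)
    also have "\<dots> = (\<Sum>k=1..L. norm (fst z) ^ (k + k) * norm (snd z) ^ (k - 1 + k))"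
      by (simp only: norm_mult norm_power complex_mod_cnj power_add mult.assoc)
    finally show "norm (snd (g_form L) z)
        \<le> (\<Sum>k=1..L. norm (fst z) ^ (k + k) * norm (snd z) ^ (k - 1 + k))" .
  qed auto
  ultimately have "L1_norm (fst (g_form L)) + L1_norm (snd (g_form L)) \<le> ennreal (pi\<^sup>2) + ennreal (pi\<^sup>2)"
    by (rule add_mono)
  then show ?thesis
    by (simp add: L1_norm_form_def case_prod_beta ennreal_plus[symmetric] del: ennreal_plus)
qed

section \<open>Harmonic growth of T and the contradiction\<close>

text \<open>For k \<ge> 1 the product of powers is at most (1/2)^2 = 1/4, which gives the constant
  3/4. All summands have the same sign, so the modulus of the sum is the sum of the moduli.\<close>

lemma norm_T_op_g_form_ge:
  assumes z: "norm z1 < 1 / 2" "norm z2 < 1"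
  shows "norm (T_op (g_form L) (z1, z2)) \<ge> 3 / 4 * harm L"
proof -
  have "3 / 4 * harm L = (\<Sum>k=1..L. 3 / 4 / real k)"
    by (simp add: harm_def sum_distrib_left inverse_eq_divide)
  also have "\<dots> \<le> (\<Sum>k=1..L. (1 - norm z1 ^ (2 * k) * norm z2 ^ (2 * k)) / real k)"
  proof (intro sum_mono divide_right_mono)
    fix k assume k: "k \<in> {1..L}"
    have "norm z1 ^ (2 * k) * norm z2 ^ (2 * k) \<le> (1 / 2) ^ (2 * k) * 1"
      using z by (intro mult_mono power_mono power_le_one) auto
    also have "\<dots> \<le> (1 / 2 :: real) ^ 2 * 1"
      using k by (intro mult_right_mono power_decreasing) auto
    finally show "3 / 4 \<le> 1 - norm z1 ^ (2 * k) * norm z2 ^ (2 * k)"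
      by (simp add: power2_eq_square)
  qed simp
  also have "\<dots> = - (\<Sum>k=1..L. (norm z1 ^ (2 * k) * norm z2 ^ (2 * k) - 1) / real k)"
    unfolding sum_negf[symmetric] by (intro sum.cong refl) (simp add: minus_divide_left)
  also have "\<dots> \<le> \<bar>\<Sum>k=1..L. (norm z1 ^ (2 * k) * norm z2 ^ (2 * k) - 1) / real k\<bar>"
    by (rule abs_ge_minus_self)
  also have "\<dots> = norm (T_op (g_form L) (z1, z2))"
    using z by (subst T_op_g_form) (auto simp only: norm_of_real)
  finally show ?thesis .
qed

text \<open>The pointwise bound is integrated over the set |z1| < 1/2, |z2| < 1, whose volume is
  (pi/4) * pi; hence 3/16 = 3/4 * 1/4.\<close>

lemma L1_norm_T_op_g_form_ge: "L1_norm (T_op (g_form L)) \<ge> ennreal (3 / 16 * pi\<^sup>2 * harm L)"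
proof -
  let ?A = "ball 0 (1 / 2) \<times> \<D> :: (complex \<times> complex) set"
  have A: "?A \<in> sets lborel"
    by (simp add: open_Times)
  have "emeasure lborel ?A = emeasure lborel (ball (0::complex) (1 / 2)) * emeasure lborel \<D>"
    by (subst lborel_prod[symmetric], subst lborel.emeasure_pair_measure_Times) auto
  also have "\<dots> = ennreal (pi\<^sup>2 / 4)"
    by (simp add: emeasure_ball unit_ball_vol_2 ennreal_mult[symmetric] power2_eq_square)
  finally have eA: "emeasure lborel ?A = ennreal (pi\<^sup>2 / 4)" .
  have "ennreal (3 / 16 * pi\<^sup>2 * harm L) = ennreal (3 / 4 * harm L) * ennreal (pi\<^sup>2 / 4)"
    by (subst ennreal_mult[symmetric]) (auto simp: harm_nonneg)
  also have "\<dots> = (\<integral>\<^sup>+z. ennreal (3 / 4 * harm L) * indicator ?A z \<partial>lborel)"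
    using A by (simp add: nn_integral_cmult_indicator eA)
  also have "\<dots> \<le> L1_norm (T_op (g_form L))"
    unfolding L1_norm_def
    by (intro nn_integral_mono)
       (auto simp: indicator_def intro!: ennreal_leI norm_T_op_g_form_ge[simplified])
  finally show ?thesis .
qed

theorem mainTheorem6:
  "(\<forall>L\<ge>1. \<forall>z\<in>\<D>\<^sup>2. dbar (g_form L) z = 0)
   \<and> (\<exists>B::real. \<forall>L\<ge>1. L1_norm_form (g_form L) \<le> ennreal B)
   \<and> \<not> (\<exists>C::real. \<forall>L\<ge>1. L1_norm (T_op (g_form L)) \<le> ennreal C * L1_norm_form (g_form L))"
proof (intro conjI)
  show "\<forall>L\<ge>1. \<forall>z\<in>\<D>\<^sup>2. dbar (g_form L) z = 0"
    by (simp add: dbar_g_form)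
  show "\<exists>B::real. \<forall>L\<ge>1. L1_norm_form (g_form L) \<le> ennreal B"
    using L1_norm_form_g_form_le by blast
  show "\<not> (\<exists>C::real. \<forall>L\<ge>1. L1_norm (T_op (g_form L)) \<le> ennreal C * L1_norm_form (g_form L))"
  proof
    assume "\<exists>C::real. \<forall>L\<ge>1. L1_norm (T_op (g_form L)) \<le> ennreal C * L1_norm_form (g_form L)"
    then obtain C where C: "\<And>L. L \<ge> 1 \<Longrightarrow> L1_norm (T_op (g_form L)) \<le> ennreal C * L1_norm_form (g_form L)"
      by blast
    \<comment> \<open>Comparing 3/16 pi^2 H_L with C * 2 pi^2 gives 32/3. Passing to
      \<open>max C 0\<close> handles negative C, for which \<open>ennreal C\<close> is 0.\<close>
    have bound: "harm L \<le> 32 / 3 * max C 0" if "L \<ge> 1" for L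
    proof -
      have "ennreal (3 / 16 * pi\<^sup>2 * harm L) \<le> ennreal (max C 0) * ennreal (2 * pi\<^sup>2)"
        by (rule order_trans[OF L1_norm_T_op_g_form_ge order_trans[OF C[OF that]]])
           (intro mult_mono L1_norm_form_g_form_le ennreal_leI; simp)
      then have "ennreal (3 / 16 * pi\<^sup>2 * harm L) \<le> ennreal (max C 0 * (2 * pi\<^sup>2))"
        by (subst ennreal_mult) auto
      then have "3 / 16 * pi\<^sup>2 * harm L \<le> max C 0 * (2 * pi\<^sup>2)"
        by (subst (asm) ennreal_le_iff) auto
      then have "pi\<^sup>2 * harm L \<le> pi\<^sup>2 * (32 / 3 * max C 0)"
        by (simp add: mult_ac)
      then show ?thesis
        by simp
    qed
    \<comment> \<open>Divergence of the harmonic series supplies an L beyond the bound; L \<ge> 1 is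
      added to match the assumed range.\<close>
    have "eventually (\<lambda>L. harm L > 32 / 3 * max C 0) sequentially"
      using harm_at_top by (auto simp only: filterlim_at_top_dense)
    then have "eventually (\<lambda>L. harm L > 32 / 3 * max C 0 \<and> L \<ge> 1) sequentially"
      using eventually_ge_at_top by (rule eventually_conj)
    then obtain L where "harm L > 32 / 3 * max C 0" "L \<ge> 1"
      by (auto dest: eventually_happens)
    with bound[of L] show False by simp
  qed
qed

end
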